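(* Let $p$ be a prime, $R=\mathbb{F}_2[x]/(x^p+1)$, and let $\mathcal{Q}=\mathrm{CC}(H_a,H_b)$ be a clustered-cyclic code over $R$ with seed sizes $n_a,n_b$, encoding $k=2n_an_b$ logical qubits. At most $$M_{\max}=k/2=n_an_b$$ $Z$-type merges can be performed within a single surgery round of parallel surgery on $\mathcal{Q}$; that is, for every product connection code $\mathcal{P}=\mathrm{LP}(H_a',H_b')$ for parallel surgery on $\mathcal{Q}$ the number of merges satisfies $M\le n_an_b$. This bound is achieved ($M=n_an_b$) whenever the product connection code satisfies $\operatorname{rank}H_Z'=n_an_b$.
   Context: For $q=\sum_i q_ix^i\in R$, $q^*=\sum_i q_ix^{-i}$ (exponents mod $p$), and $\mathbb{B}(q)\in\mathbb{F}_2^{p\times p}$ is the circulant matrix $\mathbb{B}(q)_{r,s}=q_{(s-r)\bmod p}$; for a matrix $M$ over $R$, $M^*=(M_{j,i}^* )$ and $\mathbb{B}(M)$ is obtained blockwise, so $\mathbb{B}(M^* )=\mathbb{B}(M)^{\intercal}$. The rank of a matrix over $R$ is the largest $r$ such that it has an $r\times r$ submatrix with non-zero determinant; an $m\times n$ matrix is full rank if $r=\min\{m,n\}$. Clustered-cyclic (CC) code: let $H_a\in R^{n_a\times n_a}$ and $H_b\in R^{n_b\times n_b}$ be square full-rank matrices, each of whose entries is either zero or a binomial (a sum of two distinct monomials $x^i+x^j$, $0\le i<j<p$), with the non-zero entries placed in a cyclic way so that in each matrix every row and every column has exactly the same number of non-zero entries. $\mathrm{CC}(H_a,H_b)$ is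 the CSS code with check matrices $$H_X=(\,H_a\otimes_R I_{n_b}\mid I_{n_a}\otimes_R H_b\,),\qquad H_Z=(\,I_{n_a}\otimes_R H_b^*\mid H_a^*\otimes_R I_{n_b}\,).$$ Parallel surgery for CC codes (in the $Z$ basis): the product connection code is $\mathcal{P}=\mathrm{LP}(H_a',H_b')$ with $H_a'\in R^{n_a\times n_a}$, $H_b'\in R^{n_b\times n_b}$ having every entry equal to $0$ or $1$, and $H_X'=(H_a'\otimes_R I_{n_b}\mid I_{n_a}\otimes_R H_b')$, $H_Z'=(I_{n_a}\otimes_R {H_b'}^*\mid {H_a'}^*\otimes_R I_{n_b})$. The merged code (one surgery round) has check matrices $\widetilde{H_X}=\begin{pmatrix}H_X&H_X'\\0&H_X\end{pmatrix}$, $\widetilde{H_Z}=\begin{pmatrix}H_Z&0\\H_Z'&H_Z\end{pmatrix}$. The number of $Z$-type merges (logical Pauli-product measurements) performed in the round is $$M=\dim_{\mathbb{F}_2}\,\mathbb{B}({H_Z'}^* )\big[\ker\mathbb{B}(H_Z^* )\big].$$ *)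

theory Defs
  imports
    "HOL-Library.Cardinality"
    "HOL-Library.Z2"
    "HOL-Computational_Algebra.Polynomial"
    "HOL-Computational_Algebra.Primes"
    "Jordan_Normal_Form.Matrix_Kernel"
    "Jordan_Normal_Form.DL_Rank_Submatrix"
begin

section \<open>The ring F_2[x] / (x^p + 1)\<close>

text \<open>
  The integer p is carried by a type parameter: p is the cardinality of the type \<open>'p\<close>.
\<close>

definition cyc_modulus :: "'p itself \<Rightarrow> bit poly" where
  "cyc_modulus _ = Polynomial.monom 1 CARD('p) + 1"

quotient_type 'p cyc = "bit poly" / "\<lambda>f g. cyc_modulus TYPE('p) dvd f - g"
proof (rule equivpI)
  show "reflp (\<lambda>f g. cyc_modulus TYPE('p) dvd f - g)"
    by (rule reflpI) simp
  show "symp (\<lambda>f g. cyc_modulus TYPE('p) dvd f - g)"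
    by (rule sympI) (simp add: dvd_diff_commute)
  show "transp (\<lambda>f g. cyc_modulus TYPE('p) dvd f - g)"
  proof (rule transpI)
    fix f g h
    assume "cyc_modulus TYPE('p) dvd f - g" "cyc_modulus TYPE('p) dvd g - h"
    then have "cyc_modulus TYPE('p) dvd (f - g) + (g - h)" by (rule dvd_add)
    then show "cyc_modulus TYPE('p) dvd f - h" by simp
  qed
qed

lemma cyc_modulus_not_dvd_1: "\<not> cyc_modulus TYPE('p) dvd 1"
proof (cases "CARD('p) = 0")
  case True
  then have "cyc_modulus TYPE('p) = 0"
    by (simp add: cyc_modulus_def monom_0 one_pCons)
  then show ?thesis by simp
next
  case False
  then have "degree (cyc_modulus TYPE('p)) = CARD('p)"
    unfolding cyc_modulus_def by (subst degree_add_eq_left) (simp_all add: degree_monom_eq)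
  with False show ?thesis
    by (auto dest: dvd_imp_degree_le)
qed

instantiation cyc :: (type) comm_ring_1
begin

lift_definition zero_cyc :: "'a cyc" is 0 .
lift_definition one_cyc :: "'a cyc" is 1 .

lift_definition plus_cyc :: "'a cyc \<Rightarrow> 'a cyc \<Rightarrow> 'a cyc" is "(+)"
  by (simp add: add_diff_add)

lift_definition uminus_cyc :: "'a cyc \<Rightarrow> 'a cyc" is uminus
  by (metis dvd_diff_commute minus_diff_minus dvd_minus_iff)

lift_definition minus_cyc :: "'a cyc \<Rightarrow> 'a cyc \<Rightarrow> 'a cyc" is "(-)"
proof -
  fix f f' g g' :: "bit poly"
  assume "cyc_modulus TYPE('a) dvd f - f'" "cyc_modulus TYPE('a) dvd g - g'"
  then have "cyc_modulus TYPE('a) dvd (f - f') - (g - g')" by (rule dvd_diff)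
  then show "cyc_modulus TYPE('a) dvd (f - g) - (f' - g')" by (simp add: algebra_simps)
qed

lift_definition times_cyc :: "'a cyc \<Rightarrow> 'a cyc \<Rightarrow> 'a cyc" is "(*)"
  by (simp add: mult_diff_mult)

instance
proof
  show "(0 :: 'a cyc) \<noteq> 1"
    by transfer (simp add: cyc_modulus_not_dvd_1)
qed (transfer; simp add: algebra_simps)+

end

text \<open>
  \<open>cyc_coeff q i\<close>, for \<open>i < p\<close>, is the coefficient of x^i in the representative of \<open>q\<close> of
  degree less than p.
\<close>

lift_definition cyc_coeff :: "'p cyc \<Rightarrow> nat \<Rightarrow> bit" is
  "\<lambda>f i. poly.coeff (f mod cyc_modulus TYPE('p)) i"
  by (metis mod_eq_dvd_iff)

lift_definition cyc_monom :: "nat \<Rightarrow> 'p cyc" is "\<lambda>i. Polynomial.monom 1 i" .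

definition cyc_binomial :: "'p cyc \<Rightarrow> bool" where
  "cyc_binomial q \<longleftrightarrow> (\<exists>i j. i < j \<and> j < CARD('p) \<and> q = cyc_monom i + cyc_monom j)"

definition cyc_star :: "'p cyc \<Rightarrow> 'p cyc" where
  "cyc_star q = (\<Sum>i | i < CARD('p) \<and> cyc_coeff q i = 1. cyc_monom ((CARD('p) - i) mod CARD('p)))"


section \<open>Matrices\<close>

definition mat_star :: "'p cyc mat \<Rightarrow> 'p cyc mat" where
  "mat_star M = mat (dim_col M) (dim_row M) (\<lambda>(i, j). cyc_star (M $$ (j, i)))"

definition circulant :: "'p cyc \<Rightarrow> bit mat" where
  "circulant q = mat CARD('p) CARD('p) (\<lambda>(r, s). cyc_coeff q ((s + CARD('p) - r) mod CARD('p)))"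

definition bin_mat :: "'p cyc mat \<Rightarrow> bit mat" where
  "bin_mat M = mat (dim_row M * CARD('p)) (dim_col M * CARD('p))
     (\<lambda>(u, v). circulant (M $$ (u div CARD('p), v div CARD('p)))
                 $$ (u mod CARD('p), v mod CARD('p)))"

definition kron :: "'a :: comm_ring_1 mat \<Rightarrow> 'a mat \<Rightarrow> 'a mat" where
  "kron A B = mat (dim_row A * dim_row B) (dim_col A * dim_col B)
     (\<lambda>(i, j). A $$ (i div dim_row B, j div dim_col B) * B $$ (i mod dim_row B, j mod dim_col B))"

definition hcat :: "'a mat \<Rightarrow> 'a mat \<Rightarrow> 'a mat" where
  "hcat A B = mat (dim_row A) (dim_col A + dim_col B)
     (\<lambda>(i, j). if j < dim_col A then A $$ (i, j) else B $$ (i, j - dim_col A))"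

text \<open>
  The empty submatrix has determinant 1, so the set below always contains 0.
\<close>

definition minor_rank :: "'a :: comm_ring_1 mat \<Rightarrow> nat" where
  "minor_rank A = Max {r. \<exists>I J. I \<subseteq> {..<dim_row A} \<and> J \<subseteq> {..<dim_col A} \<and>
     card I = r \<and> card J = r \<and> det (submatrix A I J) \<noteq> 0}"

definition full_rank :: "'a :: comm_ring_1 mat \<Rightarrow> bool" where
  "full_rank A \<longleftrightarrow> minor_rank A = min (dim_row A) (dim_col A)"


section \<open>Clustered-cyclic codes\<close>

text \<open>
  Cyclic placement of the non-zero entries: the pattern of each row is the pattern of the
  preceding row shifted cyclically by a fixed number \<open>c\<close> of columns. This includes right- and
  left-circulant patterns.
\<close>

definition cyclic_support :: "nat \<Rightarrow> 'p cyc mat \<Rightarrow> bool" where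
  "cyclic_support n A \<longleftrightarrow>
     (\<exists>S c. \<forall>i<n. \<forall>j<n. A $$ (i, j) \<noteq> 0 \<longleftrightarrow> (j + c * i) mod n \<in> S)"

definition regular_support :: "nat \<Rightarrow> 'p cyc mat \<Rightarrow> bool" where
  "regular_support n A \<longleftrightarrow>
     (\<exists>w. (\<forall>i<n. card {j. j < n \<and> A $$ (i, j) \<noteq> 0} = w) \<and>
          (\<forall>j<n. card {i. i < n \<and> A $$ (i, j) \<noteq> 0} = w))"

definition cc_seed :: "nat \<Rightarrow> 'p cyc mat \<Rightarrow> bool" where
  "cc_seed n A \<longleftrightarrow> 0 < n \<and> A \<in> carrier_mat n n \<and> full_rank A \<and>
     (\<forall>i<n. \<forall>j<n. A $$ (i, j) = 0 \<or> cyc_binomial (A $$ (i, j))) \<and>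
     cyclic_support n A \<and> regular_support n A"

text \<open>
  Check matrices over the ring, for square \<open>A\<close> and \<open>B\<close>; they serve both for the
  clustered-cyclic code and for the product connection code.
\<close>

definition lp_HX :: "'p cyc mat \<Rightarrow> 'p cyc mat \<Rightarrow> 'p cyc mat" where
  "lp_HX A B = hcat (kron A (1\<^sub>m (dim_row B))) (kron (1\<^sub>m (dim_row A)) B)"

definition lp_HZ :: "'p cyc mat \<Rightarrow> 'p cyc mat \<Rightarrow> 'p cyc mat" where
  "lp_HZ A B = hcat (kron (1\<^sub>m (dim_row A)) (mat_star B)) (kron (mat_star A) (1\<^sub>m (dim_row B)))"

definition bit_rank :: "bit mat \<Rightarrow> nat" where
  "bit_rank A = vec_space.rank (dim_row A) A"

definition css_logical_qubits :: "bit mat \<Rightarrow> bit mat \<Rightarrow> nat" where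
  "css_logical_qubits HX HZ = dim_col HX - bit_rank HX - bit_rank HZ"

definition cc_logical_qubits :: "'p cyc mat \<Rightarrow> 'p cyc mat \<Rightarrow> nat" where
  "cc_logical_qubits Ha Hb = css_logical_qubits (bin_mat (lp_HX Ha Hb)) (bin_mat (lp_HZ Ha Hb))"


section \<open>Parallel surgery\<close>

definition connection_seed :: "nat \<Rightarrow> 'p cyc mat \<Rightarrow> bool" where
  "connection_seed n A \<longleftrightarrow> A \<in> carrier_mat n n \<and> (\<forall>i<n. \<forall>j<n. A $$ (i, j) \<in> {0, 1})"

definition subspace_dim :: "nat \<Rightarrow> bit vec set \<Rightarrow> nat" where
  "subspace_dim n W = vectorspace.dim class_ring (module_vec TYPE(bit) n\<lparr>carrier := W\<rparr>)"

text \<open>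
  Dimension of the image under B(HZ'^*) of the kernel of B(HZ^*), where HZ and HZ' are the Z-check
  matrices of the clustered-cyclic code and of the product connection code.
\<close>

definition num_Z_merges ::
  "'p cyc mat \<Rightarrow> 'p cyc mat \<Rightarrow> 'p cyc mat \<Rightarrow> 'p cyc mat \<Rightarrow> nat" where
  "num_Z_merges Ha Hb Ha' Hb' =
     (let T = bin_mat (mat_star (lp_HZ Ha' Hb'));
          K = mat_kernel (bin_mat (mat_star (lp_HZ Ha Hb)))
      in subspace_dim (dim_row T) ((\<lambda>v. T *\<^sub>v v) ` K))"

end

(*
  Every entry of the check matrices of a clustered-cyclic code has even weight, so in each block of
  p coordinates the columns of B(HX) and B(HZ) sum to 0; hence both ranks are at most N (p - 1),
  where N = n_a n_b. Encoding k = 2 N qubits forces equality, so the columns of B(HZ) span the whole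
  space of vectors with zero block sums, and the kernel of B(HZ)^T is its orthogonal
  complement: the 2^N vectors that are constant on each block. On these, B(HZ')^T acts as the
  transpose of the coefficient-sum (augmentation) reduction of HZ', so its image has dimension at
  most N. As the entries of HZ' are 0 or 1, the reduction has the same minors as HZ', and a non-zero
  N x N minor makes the action injective. Dimensions over F_2 are read off from cardinalities.
*)
theory Submission
  imports Defs
begin

section \<open>Subspaces over the two-element field\<close>

text \<open>Coordinates with respect to a finite basis biject the carrier with the functions from
  the basis to the field. This turns every later dimension question into a count.\<close>

lemma (in vectorspace) card_carrier_eq_power_dim:
  assumes fin: "finite (carrier V)"
  shows "card (carrier V) = card (carrier K) ^ dim"
proof -
  \<comment> \<open>The carrier spans itself, so its finiteness already gives a finite generating
    set.\<close>
  have "carrier V \<subseteq> span (carrier V)" "span (carrier V) \<subseteq> carrier V"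
    by (auto intro: in_own_span[THEN subsetD] dest: span_closed[rotated])
  then have "fin_dim"
    unfolding fin_dim_def using fin by blast
  then obtain B where B: "finite B" "basis B"
    using finite_basis_exists by blast
  then have BV: "B \<subseteq> carrier V" by (simp add: basis_def)
  have uniq: "\<exists>!a. a \<in> B \<rightarrow>\<^sub>E carrier K \<and> lincomb a B = v" if "v \<in> carrier V" for v
    using basis_criterion[OF B(1) BV] B(2) that by blast
  have closed: "lincomb a B \<in> carrier V" if "a \<in> B \<rightarrow>\<^sub>E carrier K" for a
    using that BV by (intro lincomb_closed) auto
  have "bij_betw (\<lambda>a. lincomb a B) (B \<rightarrow>\<^sub>E carrier K) (carrier V)"
    unfolding bij_betw_def
  proof
    show "inj_on (\<lambda>a. lincomb a B) (B \<rightarrow>\<^sub>E carrier K)"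
      using uniq closed by (intro inj_onI) metis
    show "(\<lambda>a. lincomb a B) ` (B \<rightarrow>\<^sub>E carrier K) = carrier V"
      using uniq closed by blast
  qed
  then have "card (B \<rightarrow>\<^sub>E carrier K) = card (carrier V)"
    by (rule bij_betw_same_card)
  then show ?thesis
    using card_funcsetE[OF B(1), of "carrier K"] dim_basis[OF B] by metis
qed

lemma UNIV_bit: "(UNIV :: bit set) = {0, 1}"
  using bit_not_zero_iff by auto

lemma bit_cases_zero_one: "b = 0 \<or> b = (1 :: bit)"
  using bit_not_zero_iff by auto

lemma finite_carrier_vec_bit: "finite (carrier_vec n :: bit vec set)"
proof -
  have "carrier_vec n \<subseteq> vec_of_list ` {xs. set xs \<subseteq> (UNIV :: bit set) \<and> length xs = n}"
    by (auto intro!: image_eqI[of _ _ "list_of_vec _"] simp: vec_list)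
  moreover have "finite {xs. set xs \<subseteq> (UNIV :: bit set) \<and> length xs = n}"
    by (rule finite_lists_length_eq) (simp add: UNIV_bit)
  ultimately show ?thesis
    by (meson finite_imageI finite_subset)
qed

text \<open>The only scalars are 0 and 1, so closure under scaling follows from containing the zero
  vector.\<close>

lemma submodule_bit_vecI:
  assumes "W \<subseteq> carrier_vec n" "0\<^sub>v n \<in> W"
    and "\<And>v w. v \<in> W \<Longrightarrow> w \<in> W \<Longrightarrow> v + w \<in> W"
  shows "LinearCombinations.submodule class_ring W (module_vec TYPE(bit) n)"
proof -
  have "c \<cdot>\<^sub>v v \<in> W" if "v \<in> W" for c :: bit and v
  proof -
    have "v \<in> carrier_vec n" using assms(1) that by blast
    then have "0 \<cdot>\<^sub>v v = 0\<^sub>v n" by auto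
    then show ?thesis
      using bit_cases_zero_one[of c] assms(2) that by auto
  qed
  with assms vec_module[where n = n and 'a = bit] show ?thesis
    unfolding LinearCombinations.submodule_def by (auto simp: module_vec_simps)
qed

lemma card_submodule_bit_vec:
  assumes "LinearCombinations.submodule class_ring W (module_vec TYPE(bit) n)"
  shows "card W = 2 ^ subspace_dim n W"
proof -
  interpret V: vec_space "TYPE(bit)" n .
  have W: "W \<subseteq> carrier_vec n"
    using assms unfolding LinearCombinations.submodule_def by (simp add: module_vec_simps)
  have "VectorSpace.subspace class_ring W (module_vec TYPE(bit) n)"
    unfolding VectorSpace.subspace_def using assms V.vectorspace_axioms by simp
  then have "vectorspace class_ring (module_vec TYPE(bit) n\<lparr>carrier := W\<rparr>)"
    by (rule V.subspace_is_vs)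
  from vectorspace.card_carrier_eq_power_dim[OF this]
  show ?thesis
    using finite_subset[OF W finite_carrier_vec_bit]
    by (simp add: subspace_dim_def class_ring_simps UNIV_bit numeral_2_eq_2)
qed

lemma card_carrier_vec_bit: "card (carrier_vec n :: bit vec set) = 2 ^ n"
proof -
  interpret V: vec_space "TYPE(bit)" n .
  show ?thesis
    using V.card_carrier_eq_power_dim V.dim_is_n finite_carrier_vec_bit[of n]
    by (simp add: UNIV_bit numeral_2_eq_2)
qed

abbreviation col_span :: "bit mat \<Rightarrow> bit vec set" where
  "col_span A \<equiv> LinearCombinations.module.span class_ring (module_vec TYPE(bit) (dim_row A)) (set (cols A))"

lemma submodule_col_span:
  "LinearCombinations.submodule class_ring (col_span A) (module_vec TYPE(bit) (dim_row A))"
proof -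
  interpret V: vec_space "TYPE(bit)" "dim_row A" .
  show ?thesis
    by (rule V.span_is_submodule) (simp add: cols_dim)
qed

lemma card_col_span: "card (col_span A) = 2 ^ bit_rank A"
  using card_submodule_bit_vec[OF submodule_col_span, of A]
  by (simp add: bit_rank_def vec_space.rank_def subspace_dim_def)

lemma col_span_subset:
  assumes "set (cols A) \<subseteq> W"
    and "LinearCombinations.submodule class_ring W (module_vec TYPE(bit) (dim_row A))"
  shows "col_span A \<subseteq> W"
proof -
  interpret V: vec_space "TYPE(bit)" "dim_row A" .
  show ?thesis
    using assms by (intro V.span_is_subset)
qed

section \<open>Coefficient sums in the cyclic ring\<close>

text \<open>Positivity excludes infinite types, where \<open>CARD('p)\<close> is 0 and the modulus
  degenerates to 1 + 1 = 0.\<close>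

lemma degree_cyc_modulus:
  assumes "0 < CARD('p)"
  shows "degree (cyc_modulus TYPE('p)) = CARD('p)"
  unfolding cyc_modulus_def using assms
  by (subst degree_add_eq_left) (simp_all add: degree_monom_eq)

lemma cyc_coeff_0 [simp]: "cyc_coeff 0 i = 0"
  by transfer simp

lemma cyc_coeff_add [simp]: "cyc_coeff (a + b) i = cyc_coeff a i + cyc_coeff b i"
  by transfer (simp add: poly_mod_add_left)

lemma cyc_coeff_sum [simp]: "cyc_coeff (sum f S) i = (\<Sum>s\<in>S. cyc_coeff (f s) i)"
  by (induction S rule: infinite_finite_induct) simp_all

lemma cyc_coeff_monom:
  assumes "i < CARD('p)"
  shows "cyc_coeff (cyc_monom i :: 'p cyc) j = (if j = i then 1 else 0)"
  using assms
proof (transfer fixing: i j)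
  assume i: "i < CARD('p)"
  then have "Polynomial.monom 1 i mod cyc_modulus TYPE('p) = (Polynomial.monom 1 i :: bit poly)"
    using degree_cyc_modulus[where 'p = 'p] by (intro mod_poly_less) (simp add: degree_monom_eq)
  then show "poly.coeff (Polynomial.monom 1 i mod cyc_modulus TYPE('p)) j = (if j = i then 1 else 0)"
    by auto
qed

lemma cyc_monom_0: "cyc_monom 0 = 1"
  by transfer (simp add: monom_0 one_pCons)

lemma cyc_coeff_1:
  assumes "0 < CARD('p)"
  shows "cyc_coeff (1 :: 'p cyc) j = (if j = 0 then 1 else 0)"
  using cyc_coeff_monom[where 'p = 'p and i = 0] assms by (simp add: cyc_monom_0)

lemma two_cyc_eq_0: "(2 :: 'p cyc) = 0"
proof -
  have "(1 :: bit poly) + 1 = 0"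
    by (intro poly_eqI) (simp only: coeff_add coeff_1 coeff_0, simp)
  then have "(1 :: 'p cyc) + 1 = 0"
    by (transfer fixing:) simp
  then show ?thesis by simp
qed

lemma mod_neg_eq_iff:
  fixes i j p :: nat
  assumes "i < p" "j < p"
  shows "j = (p - i) mod p \<longleftrightarrow> i = (p - j) mod p"
  using assms by (cases "i = 0"; cases "j = 0") auto

text \<open>Negation modulo p is an involution on exponents, so exactly one exponent of the support,
  namely -j, can contribute to the coefficient at j.\<close>

lemma cyc_coeff_star:
  fixes q :: "'p cyc"
  assumes j: "j < CARD('p)"
  shows "cyc_coeff (cyc_star q) j = cyc_coeff q ((CARD('p) - j) mod CARD('p))"
proof -
  let ?p = "CARD('p)"
  let ?m = "(?p - j) mod ?p"
  have m: "?m < ?p" using j by (intro mod_less_divisor) linarith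
  have "cyc_coeff (cyc_star q) j = (\<Sum>i | i < ?p \<and> cyc_coeff q i = 1. if j = (?p - i) mod ?p then 1 else 0)"
    unfolding cyc_star_def cyc_coeff_sum using j
    by (intro sum.cong refl cyc_coeff_monom mod_less_divisor) linarith
  also have "\<dots> = (\<Sum>i | i < ?p \<and> cyc_coeff q i = 1. if i = ?m then 1 else 0)"
    using j by (intro sum.cong refl) (auto simp: mod_neg_eq_iff)
  also have "\<dots> = cyc_coeff q ?m"
    using m by (subst sum.delta) auto
  finally show ?thesis .
qed

text \<open>This is evaluation at x = 1, which is well defined on the quotient because x^p + 1
  vanishes there over F_2. Its value is the parity of the weight.\<close>

definition augmentation :: "'p cyc \<Rightarrow> bit" where
  "augmentation q = (\<Sum>i<CARD('p). cyc_coeff q i)"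

lemma augmentation_0 [simp]: "augmentation 0 = 0"
  by (simp add: augmentation_def)

lemma augmentation_add: "augmentation (a + b) = augmentation a + augmentation b"
  by (simp only: augmentation_def cyc_coeff_add sum.distrib)

lemma augmentation_monom:
  assumes "i < CARD('p)"
  shows "augmentation (cyc_monom i :: 'p cyc) = 1"
  using assms by (simp add: augmentation_def cyc_coeff_monom)

lemma augmentation_1:
  assumes "0 < CARD('p)"
  shows "augmentation (1 :: 'p cyc) = 1"
  using augmentation_monom[OF assms] by (simp add: cyc_monom_0)

text \<open>Each monomial contributes 1, and 1 + 1 = 0. This is how the binomial entries of the
  seeds enter the argument.\<close>

lemma augmentation_binomial:
  fixes q :: "'p cyc"
  assumes "cyc_binomial q"
  shows "augmentation q = 0"
proof -
  obtain i j where "i < j" "j < CARD('p)" "q = cyc_monom i + cyc_monom j"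
    using assms by (auto simp: cyc_binomial_def)
  then show ?thesis by (simp add: augmentation_add augmentation_monom)
qed

text \<open>The cyclic index expressions below stay under 2p, so each reduction modulo p becomes one
  case split, after which the goals are linear.\<close>

lemma mod_if_less_double:
  fixes a p :: nat
  assumes "a < 2 * p"
  shows "a mod p = (if a < p then a else a - p)"
  using assms by (simp add: le_mod_geq not_less)

lemma augmentation_star:
  fixes q :: "'p cyc"
  shows "augmentation (cyc_star q) = augmentation q"
  unfolding augmentation_def
  by (rule sum.reindex_bij_witness[where i = "\<lambda>j. (CARD('p) - j) mod CARD('p)"
        and j = "\<lambda>j. (CARD('p) - j) mod CARD('p)"])
    (auto simp: mod_if_less_double cyc_coeff_star)

lemma cyc_star_0 [simp]: "cyc_star 0 = 0"
  by (simp add: cyc_star_def)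

lemma cyc_star_1:
  assumes "0 < CARD('p)"
  shows "cyc_star (1 :: 'p cyc) = 1"
proof -
  have "{i. i < CARD('p) \<and> cyc_coeff (1 :: 'p cyc) i = 1} = {0}"
    using assms by (auto simp: cyc_coeff_1 split: if_splits)
  then show ?thesis
    unfolding cyc_star_def by (simp add: cyc_monom_0)
qed

lemma circulant_star: "circulant (cyc_star q) = transpose_mat (circulant (q :: 'p cyc))"
proof (rule eq_matI)
  fix r s assume "r < dim_row (transpose_mat (circulant q))" "s < dim_col (transpose_mat (circulant q))"
  then have rs: "r < CARD('p)" "s < CARD('p)" by (simp_all add: circulant_def)
  then have "(CARD('p) - (s + CARD('p) - r) mod CARD('p)) mod CARD('p) = (r + CARD('p) - s) mod CARD('p)"
    by (auto simp: mod_if_less_double)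
  with rs show "circulant (cyc_star q) $$ (r, s) = transpose_mat (circulant q) $$ (r, s)"
    by (simp add: circulant_def cyc_coeff_star)
qed (simp_all add: circulant_def)

text \<open>For fixed r, the difference s - r runs once through all residues as s does; the column
  version follows by transposing.\<close>

lemma circulant_row_sum:
  fixes q :: "'p cyc"
  assumes "r < CARD('p)"
  shows "(\<Sum>s<CARD('p). circulant q $$ (r, s)) = augmentation q"
proof -
  have "(\<Sum>s<CARD('p). cyc_coeff q ((s + CARD('p) - r) mod CARD('p))) = augmentation q"
    unfolding augmentation_def using assms
    by (intro sum.reindex_bij_witness[where i = "\<lambda>i. (i + r) mod CARD('p)"
        and j = "\<lambda>s. (s + CARD('p) - r) mod CARD('p)"])
      (auto simp: mod_if_less_double)
  then show ?thesis
    using assms by (simp add: circulant_def)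
qed

lemma circulant_col_sum:
  fixes q :: "'p cyc"
  assumes "s < CARD('p)"
  shows "(\<Sum>r<CARD('p). circulant q $$ (r, s)) = augmentation q"
proof -
  have "(\<Sum>r<CARD('p). circulant q $$ (r, s)) = (\<Sum>r<CARD('p). circulant (cyc_star q) $$ (s, r))"
    using assms by (intro sum.cong refl) (simp add: circulant_star, simp add: circulant_def)
  also have "\<dots> = augmentation q"
    using circulant_row_sum[OF assms, of "cyc_star q"] by (simp add: augmentation_star)
  finally show ?thesis .
qed

text \<open>The embedding of F_2 as the constants of R. Being a ring homomorphism, it commutes with
  determinants and so relates minors over R to minors over F_2.\<close>

definition bit_to_cyc :: "bit \<Rightarrow> 'p cyc" where
  "bit_to_cyc b = (if b = 1 then 1 else 0)"

lemma comm_ring_hom_bit_to_cyc: "comm_ring_hom (bit_to_cyc :: bit \<Rightarrow> 'p cyc)"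
proof
  fix x y :: bit
  show "bit_to_cyc (x + y) = (bit_to_cyc x + bit_to_cyc y :: 'p cyc)"
    by (cases x; cases y) (simp_all add: bit_to_cyc_def two_cyc_eq_0)
  show "bit_to_cyc (x * y) = (bit_to_cyc x * bit_to_cyc y :: 'p cyc)"
    by (cases x; cases y) (simp_all add: bit_to_cyc_def)
qed (simp_all add: bit_to_cyc_def)

section \<open>Vectors with block structure\<close>

lemma sum_lessThan_mult:
  fixes f :: "nat \<Rightarrow> 'a :: comm_monoid_add"
  shows "(\<Sum>v<n * k. f v) = (\<Sum>b<n. \<Sum>s<k. f (b * k + s))"
proof -
  have "sum f {b * k..<b * k + k} = (\<Sum>s<k. f (b * k + s))" for b
    by (rule sum.reindex_bij_witness[where i = "\<lambda>s. b * k + s" and j = "\<lambda>v. v - b * k"]) auto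
  then show ?thesis
    using sum.nat_group[of f k n] by simp
qed

lemma less_mult_imp_div_mod_less:
  fixes i n k :: nat
  assumes "i < n * k"
  shows "i div k < n" "i mod k < k"
  using assms by (cases "k = 0"; simp add: less_mult_imp_div_less)+

lemma block_index_less:
  fixes b s n k :: nat
  assumes "b < n" "s < k"
  shows "b * k + s < n * k"
proof -
  have "b * k + s < Suc b * k" using assms by simp
  also have "\<dots> \<le> n * k" using assms by (intro mult_le_mono1) simp
  finally show ?thesis .
qed

lemma dim_bin_mat [simp]:
  "dim_row (bin_mat (M :: 'p cyc mat)) = dim_row M * CARD('p)"
  "dim_col (bin_mat (M :: 'p cyc mat)) = dim_col M * CARD('p)"
  by (simp_all add: bin_mat_def)

lemma bin_mat_index:
  fixes M :: "'p cyc mat"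
  assumes "u < dim_row M * CARD('p)" "v < dim_col M * CARD('p)"
  shows "bin_mat M $$ (u, v) =
    circulant (M $$ (u div CARD('p), v div CARD('p))) $$ (u mod CARD('p), v mod CARD('p))"
  using assms by (simp add: bin_mat_def)

lemma bin_mat_star: "bin_mat (mat_star M) = transpose_mat (bin_mat (M :: 'p cyc mat))"
proof (rule eq_matI)
  fix i j assume "i < dim_row (transpose_mat (bin_mat M))" "j < dim_col (transpose_mat (bin_mat M))"
  then have ij: "i < dim_col M * CARD('p)" "j < dim_row M * CARD('p)" by simp_all
  note lt = less_mult_imp_div_mod_less[OF ij(1)] less_mult_imp_div_mod_less[OF ij(2)]
  show "bin_mat (mat_star M) $$ (i, j) = transpose_mat (bin_mat M) $$ (i, j)"
    using ij lt by (simp add: bin_mat_index mat_star_def circulant_star) (simp add: circulant_def)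
qed (simp_all add: mat_star_def)

section \<open>Block-constant vectors and vectors with zero block sums\<close>

definition block_const_vec :: "nat \<Rightarrow> 'a vec \<Rightarrow> 'a vec" where
  "block_const_vec k x = vec (dim_vec x * k) (\<lambda>i. x $ (i div k))"

text \<open>The orthogonal complement of the block-constant vectors. For k = p over F_2 these are
  the coefficient vectors of n-tuples from the augmentation ideal.\<close>

definition zero_sum_blocks :: "nat \<Rightarrow> nat \<Rightarrow> 'a :: comm_ring_1 vec set" where
  "zero_sum_blocks n k = {v \<in> carrier_vec (n * k). \<forall>b<n. (\<Sum>s<k. v $ (b * k + s)) = 0}"

lemma dim_zero_sum_blocks: "v \<in> zero_sum_blocks n k \<Longrightarrow> dim_vec v = n * k"
  by (rule carrier_vecD) (simp add: zero_sum_blocks_def)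

lemma block_const_vec_carrier [simp]:
  "x \<in> carrier_vec n \<Longrightarrow> block_const_vec k x \<in> carrier_vec (n * k)"
  by (simp add: block_const_vec_def)

lemma block_const_vec_index:
  assumes "x \<in> carrier_vec n" "i < n * k"
  shows "block_const_vec k x $ i = x $ (i div k)"
  using assms by (simp add: block_const_vec_def)

lemma inj_on_block_const_vec:
  assumes "0 < k"
  shows "inj_on (block_const_vec k) (carrier_vec n)"
proof (rule inj_onI)
  fix x y :: "'a vec"
  assume xy: "x \<in> carrier_vec n" "y \<in> carrier_vec n" "block_const_vec k x = block_const_vec k y"
  show "x = y"
  proof (rule eq_vecI)
    fix b assume "b < dim_vec y"
    then have "b * k < n * k" using xy assms by simp
    then show "x $ b = y $ b"
      using block_const_vec_index[OF xy(1), of "b * k" k] block_const_vec_index[OF xy(2), of "b * k" k]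
        xy(3) assms by simp
  qed (use xy in simp)
qed

text \<open>A circulant maps a constant vector to a constant vector, scaled by its common row sum.
  Hence on block-constant vectors the binary matrix acts as the much smaller augmented
  matrix.\<close>

lemma bin_mat_mult_block_const_vec:
  fixes M :: "'p cyc mat"
  assumes x: "x \<in> carrier_vec (dim_col M)"
  shows "bin_mat M *\<^sub>v block_const_vec CARD('p) x =
    block_const_vec CARD('p) (map_mat augmentation M *\<^sub>v x)"
proof (rule eq_vecI)
  let ?p = "CARD('p)"
  fix i assume "i < dim_vec (block_const_vec ?p (map_mat augmentation M *\<^sub>v x))"
  then have i: "i < dim_row M * ?p" by (simp add: block_const_vec_def)
  note id = less_mult_imp_div_mod_less[OF i]
  have "(bin_mat M *\<^sub>v block_const_vec ?p x) $ i =
      (\<Sum>v<dim_col M * ?p. bin_mat M $$ (i, v) * x $ (v div ?p))"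
    using x i by (simp add: scalar_prod_def lessThan_atLeast0 block_const_vec_def)
  also have "\<dots> = (\<Sum>c<dim_col M. \<Sum>s<?p. bin_mat M $$ (i, c * ?p + s) * x $ ((c * ?p + s) div ?p))"
    by (rule sum_lessThan_mult)
  also have "\<dots> = (\<Sum>c<dim_col M. (\<Sum>s<?p. circulant (M $$ (i div ?p, c)) $$ (i mod ?p, s)) * x $ c)"
    unfolding sum_distrib_right
  proof (intro sum.cong refl)
    fix c s assume "c \<in> {..<dim_col M}" "s \<in> {..<?p}"
    then show "bin_mat M $$ (i, c * ?p + s) * x $ ((c * ?p + s) div ?p) =
        circulant (M $$ (i div ?p, c)) $$ (i mod ?p, s) * x $ c"
      using i block_index_less[of c "dim_col M" s ?p] by (simp add: bin_mat_index)
  qed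
  also have "\<dots> = (\<Sum>c<dim_col M. augmentation (M $$ (i div ?p, c)) * x $ c)"
    using id by (simp add: circulant_row_sum)
  also have "\<dots> = block_const_vec ?p (map_mat augmentation M *\<^sub>v x) $ i"
    using x i id by (simp add: block_const_vec_def scalar_prod_def lessThan_atLeast0)
  finally show "(bin_mat M *\<^sub>v block_const_vec ?p x) $ i =
    block_const_vec ?p (map_mat augmentation M *\<^sub>v x) $ i" .
qed (simp add: block_const_vec_def)

lemma submodule_zero_sum_blocks:
  "LinearCombinations.submodule class_ring (zero_sum_blocks n k) (module_vec TYPE(bit) (n * k))"
proof (rule submodule_bit_vecI)
  fix v w :: "bit vec"
  assume v: "v \<in> zero_sum_blocks n k" and w: "w \<in> zero_sum_blocks n k"
  then have vw: "v \<in> carrier_vec (n * k)" "w \<in> carrier_vec (n * k)"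
    by (simp_all add: zero_sum_blocks_def)
  have "(\<Sum>s<k. (v + w) $ (b * k + s)) = 0" if b: "b < n" for b
  proof -
    have "(\<Sum>s<k. (v + w) $ (b * k + s)) = (\<Sum>s<k. v $ (b * k + s) + w $ (b * k + s))"
      using vw block_index_less[OF b] by (intro sum.cong refl index_add_vec(1)) simp
    also have "\<dots> = (\<Sum>s<k. v $ (b * k + s)) + (\<Sum>s<k. w $ (b * k + s))"
      by (rule sum.distrib)
    finally show ?thesis
      using v w b by (simp add: zero_sum_blocks_def)
  qed
  then show "v + w \<in> zero_sum_blocks n k"
    using vw by (simp add: zero_sum_blocks_def)
qed (auto simp: zero_sum_blocks_def block_index_less)

text \<open>The last entry of each block is determined by the others, so restriction to the first k
  - 1 positions of every block is injective.\<close>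

lemma card_zero_sum_blocks_le:
  assumes "0 < k"
  shows "card (zero_sum_blocks n k :: bit vec set) \<le> 2 ^ (n * (k - 1))"
proof -
  let ?I = "{..<n} \<times> {..<k - 1}"
  let ?f = "\<lambda>v :: bit vec. restrict (\<lambda>(b, s). v $ (b * k + s)) ?I"
  have inj: "inj_on ?f (zero_sum_blocks n k)"
  proof (rule inj_onI)
    fix v w :: "bit vec"
    assume v: "v \<in> zero_sum_blocks n k" and w: "w \<in> zero_sum_blocks n k" and eq: "?f v = ?f w"
    have small: "v $ (b * k + s) = w $ (b * k + s)" if "b < n" "s < k - 1" for b s
      using fun_cong[OF eq, of "(b, s)"] that by simp
    have last: "u $ (b * k + (k - 1)) = - (\<Sum>s<k - 1. u $ (b * k + s))"
      if "u \<in> zero_sum_blocks n k" "b < n" for u :: "bit vec" and b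
    proof -
      have "(\<Sum>s<Suc (k - 1). u $ (b * k + s)) = 0"
        using that assms by (simp add: zero_sum_blocks_def del: sum.lessThan_Suc)
      then show ?thesis
        by (simp only: sum.lessThan_Suc add.commute eq_neg_iff_add_eq_0)
    qed
    show "v = w"
    proof (rule eq_vecI)
      fix i assume "i < dim_vec w"
      then have i: "i < n * k" using dim_zero_sum_blocks[OF w] by simp
      note id = less_mult_imp_div_mod_less[OF i]
      have "v $ (i div k * k + i mod k) = w $ (i div k * k + i mod k)"
      proof (cases "i mod k < k - 1")
        case False
        then have "i mod k = k - 1" using id by linarith
        then show ?thesis
          using last[OF v id(1)] last[OF w id(1)] small[OF id(1)] by (simp del: uminus_bit_def)
      qed (use small id in blast)
      then show "v $ i = w $ i" by simp
    qed (simp add: dim_zero_sum_blocks[OF v] dim_zero_sum_blocks[OF w])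
  qed
  have fin: "finite (?I \<rightarrow>\<^sub>E (UNIV :: bit set))"
    by (intro finite_PiE) (simp_all add: UNIV_bit)
  have "card (zero_sum_blocks n k :: bit vec set) \<le> card (?I \<rightarrow>\<^sub>E (UNIV :: bit set))"
    by (rule card_inj_on_le[OF inj _ fin]) (simp add: image_subset_iff restrict_PiE_iff)
  also have "\<dots> = 2 ^ (n * (k - 1))"
    by (subst card_funcsetE) (simp_all add: UNIV_bit card_cartesian_product numeral_2_eq_2)
  finally show ?thesis .
qed

lemma orthogonal_zero_sum_blocks:
  fixes v :: "'a :: comm_ring_1 vec"
  assumes v: "v \<in> carrier_vec (n * k)"
    and orth: "\<And>w. w \<in> zero_sum_blocks n k \<Longrightarrow> w \<bullet> v = 0"
  shows "v \<in> block_const_vec k ` carrier_vec n"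
proof (rule image_eqI)
  let ?x = "vec n (\<lambda>b. v $ (b * k))"
  show "?x \<in> carrier_vec n" by simp
  show "v = block_const_vec k ?x"
  proof (rule eq_vecI)
    fix i assume "i < dim_vec (block_const_vec k ?x)"
    then have i: "i < n * k" by (simp add: block_const_vec_def)
    note id = less_mult_imp_div_mod_less[OF i]
    \<comment> \<open>The first position of the block containing i. The difference of the two unit
      vectors has zero block sums, so orthogonality to it forces v to agree at i and
      \<open>?j\<close>.\<close>
    let ?j = "i div k * k"
    have j: "?j < n * k" using block_index_less[OF id(1), of 0 k] id by simp
    let ?w = "unit_vec (n * k) i - unit_vec (n * k) ?j :: 'a vec"
    have "(\<Sum>s<k. ?w $ (b * k + s)) = 0" if b: "b < n" for b
    proof -
      \<comment> \<open>The sum of a unit vector over block b detects whether its support lies in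
        that block; i and \<open>?j\<close> share a block, so the two sums cancel.\<close>
      have *: "(\<Sum>s<k. unit_vec (n * k) l $ (b * k + s)) = (if l div k = b then 1 else 0 :: 'a)"
        if l: "l < n * k" for l
      proof -
        have "(\<Sum>s<k. unit_vec (n * k) l $ (b * k + s)) =
            (\<Sum>s<k. if s = l mod k then (if l div k = b then 1 else 0 :: 'a) else 0)"
        proof (intro sum.cong refl)
          fix s assume "s \<in> {..<k}"
          then have s: "s < k" by simp
          then have "l = b * k + s \<longleftrightarrow> s = l mod k \<and> l div k = b"
            using div_mult_mod_eq[of l k] by auto
          then show "unit_vec (n * k) l $ (b * k + s) =
              (if s = l mod k then (if l div k = b then 1 else 0 :: 'a) else 0)"
            using block_index_less[OF b s] l by (auto simp: index_unit_vec(1))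
        qed
        then show ?thesis using less_mult_imp_div_mod_less[OF l] by simp
      qed
      have "(\<Sum>s<k. ?w $ (b * k + s)) =
          (\<Sum>s<k. unit_vec (n * k) i $ (b * k + s)) - (\<Sum>s<k. unit_vec (n * k) ?j $ (b * k + s))"
        using block_index_less[OF b] by (simp add: sum_subtractf)
      then show ?thesis using *[OF i] *[OF j] id by simp
    qed
    then have "?w \<in> zero_sum_blocks n k" by (simp add: zero_sum_blocks_def)
    from orth[OF this] have "v $ i = v $ ?j"
      using v i j by (simp add: minus_scalar_prod_distrib[where n = "n * k"] scalar_prod_left_unit)
    then show "v $ i = block_const_vec k ?x $ i"
      using i id by (simp add: block_const_vec_def)
  qed (use v in \<open>simp add: block_const_vec_def\<close>)
qed

section \<open>Check matrices and merges\<close>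

definition all_entries :: "('a \<Rightarrow> bool) \<Rightarrow> 'a mat \<Rightarrow> bool" where
  "all_entries P M \<longleftrightarrow> (\<forall>i<dim_row M. \<forall>j<dim_col M. P (M $$ (i, j)))"

lemma all_entries_hcat:
  assumes "all_entries P A" "all_entries P B" "dim_row A = dim_row B"
  shows "all_entries P (hcat A B)"
  using assms by (auto simp: all_entries_def hcat_def)

text \<open>Every entry of the product is an entry of \<open>A\<close> times 0 or 1, hence the
  condition \<open>P 0\<close>. The predicate is later instantiated both with zero augmentation and
  with membership in {0, 1}.\<close>

lemma all_entries_kron_one_right:
  assumes "all_entries P A" "P 0"
  shows "all_entries P (kron A (1\<^sub>m n))"
  using assms by (auto simp: all_entries_def kron_def less_mult_imp_div_mod_less)

lemma all_entries_kron_one_left: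
  assumes "all_entries P A" "P 0"
  shows "all_entries P (kron (1\<^sub>m n) A)"
  using assms by (auto simp: all_entries_def kron_def less_mult_imp_div_mod_less)

lemma all_entries_mat_star:
  assumes "all_entries P A" "\<And>q. P q \<Longrightarrow> Q (cyc_star q)"
  shows "all_entries Q (mat_star A)"
  using assms by (simp add: all_entries_def mat_star_def)

lemma dim_mat_star [simp]:
  "dim_row (mat_star M) = dim_col M" "dim_col (mat_star M) = dim_row M"
  by (simp_all add: mat_star_def)

lemma dim_kron [simp]:
  "dim_row (kron A B) = dim_row A * dim_row B" "dim_col (kron A B) = dim_col A * dim_col B"
  by (simp_all add: kron_def)

lemma dim_hcat [simp]:
  "dim_row (hcat A B) = dim_row A" "dim_col (hcat A B) = dim_col A + dim_col B"
  by (simp_all add: hcat_def)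

lemma dim_lp_HX:
  assumes "A \<in> carrier_mat na na" "B \<in> carrier_mat nb nb"
  shows "dim_row (lp_HX A B) = na * nb" "dim_col (lp_HX A B) = 2 * (na * nb)"
  using assms by (simp_all add: lp_HX_def)

lemma dim_lp_HZ:
  assumes "A \<in> carrier_mat na na" "B \<in> carrier_mat nb nb"
  shows "dim_row (lp_HZ A B) = na * nb" "dim_col (lp_HZ A B) = 2 * (na * nb)"
  using assms by (simp_all add: lp_HZ_def)

lemma all_entries_lp_HX:
  assumes "A \<in> carrier_mat na na" "B \<in> carrier_mat nb nb"
    and "all_entries P A" "all_entries P B" "P 0"
  shows "all_entries P (lp_HX A B)"
  unfolding lp_HX_def using assms
  by (intro all_entries_hcat all_entries_kron_one_right all_entries_kron_one_left) simp_all

lemma all_entries_lp_HZ: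
  assumes "A \<in> carrier_mat na na" "B \<in> carrier_mat nb nb"
    and "all_entries P A" "all_entries P B" "P 0" "\<And>q. P q \<Longrightarrow> P (cyc_star q)"
  shows "all_entries P (lp_HZ A B)"
  unfolding lp_HZ_def using assms
  by (intro all_entries_hcat all_entries_kron_one_right all_entries_kron_one_left
      all_entries_mat_star[where P = P]) simp_all

section \<open>Column spaces, rank bounds and kernels for entries of even weight\<close>

lemma cols_bin_mat_zero_sum_blocks:
  fixes M :: "'p cyc mat"
  assumes M: "all_entries (\<lambda>q. augmentation q = 0) M"
  shows "set (cols (bin_mat M)) \<subseteq> zero_sum_blocks (dim_row M) CARD('p)"
proof
  let ?p = "CARD('p)"
  fix w assume "w \<in> set (cols (bin_mat M))"
  then obtain v where v: "v < dim_col M * ?p" "w = col (bin_mat M) v"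
    by (auto simp: cols_def)
  note vd = less_mult_imp_div_mod_less[OF v(1)]
  have "(\<Sum>s<?p. w $ (b * ?p + s)) = 0" if b: "b < dim_row M" for b
  proof -
    \<comment> \<open>Inside one block, a column of the binary matrix is a column of a single
      circulant, whose sum is the augmentation of the corresponding entry.\<close>
    have "(\<Sum>s<?p. w $ (b * ?p + s)) = (\<Sum>s<?p. circulant (M $$ (b, v div ?p)) $$ (s, v mod ?p))"
      using v b block_index_less[OF b] by (intro sum.cong refl) (simp add: bin_mat_index)
    also have "\<dots> = 0"
      using M b vd by (simp add: circulant_col_sum all_entries_def)
    finally show ?thesis .
  qed
  moreover have "w \<in> carrier_vec (dim_row M * ?p)"
    using col_dim[of "bin_mat M" v] v(2) by simp
  ultimately show "w \<in> zero_sum_blocks (dim_row M) ?p"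
    unfolding zero_sum_blocks_def by blast
qed

lemma finite_zero_sum_blocks: "finite (zero_sum_blocks n k :: bit vec set)"
  by (rule finite_subset[OF _ finite_carrier_vec_bit[of "n * k"]]) (auto simp: zero_sum_blocks_def)

lemma col_span_bin_mat_zero_sum_blocks:
  fixes M :: "'p cyc mat"
  assumes "all_entries (\<lambda>q. augmentation q = 0) M"
  shows "col_span (bin_mat M) \<subseteq> zero_sum_blocks (dim_row M) CARD('p)"
  using submodule_zero_sum_blocks[of "dim_row M" "CARD('p)"]
  by (intro col_span_subset[OF cols_bin_mat_zero_sum_blocks[OF assms]]) simp

lemma bit_rank_bin_mat_le:
  fixes M :: "'p cyc mat"
  assumes "all_entries (\<lambda>q. augmentation q = 0) M" "0 < CARD('p)"
  shows "bit_rank (bin_mat M) \<le> dim_row M * (CARD('p) - 1)"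
proof -
  have "(2 :: nat) ^ bit_rank (bin_mat M) = card (col_span (bin_mat M))"
    by (rule card_col_span[symmetric])
  also have "\<dots> \<le> card (zero_sum_blocks (dim_row M) CARD('p) :: bit vec set)"
    by (rule card_mono[OF finite_zero_sum_blocks col_span_bin_mat_zero_sum_blocks[OF assms(1)]])
  also have "\<dots> \<le> 2 ^ (dim_row M * (CARD('p) - 1))"
    by (rule card_zero_sum_blocks_le[OF assms(2)])
  finally show ?thesis by simp
qed

lemma map_mat_augmentation_star:
  "map_mat augmentation (mat_star M) = transpose_mat (map_mat augmentation M)"
  by (rule eq_matI) (simp_all add: mat_star_def augmentation_star)

text \<open>Maximal rank makes the columns span all vectors with zero block sums; the kernel of the
  transpose is the orthogonal complement of that span.\<close>

lemma mat_kernel_bin_mat_star: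
  fixes M :: "'p cyc mat"
  assumes M: "all_entries (\<lambda>q. augmentation q = 0) M" and p: "0 < CARD('p)"
    and rank: "bit_rank (bin_mat M) = dim_row M * (CARD('p) - 1)"
  shows "mat_kernel (bin_mat (mat_star M)) = block_const_vec CARD('p) ` carrier_vec (dim_row M)"
proof (intro equalityI subsetI)
  let ?p = "CARD('p)" and ?n = "dim_row M"
  fix v :: "bit vec" assume "v \<in> block_const_vec ?p ` carrier_vec ?n"
  then obtain x where x: "x \<in> carrier_vec ?n" "v = block_const_vec ?p x" by blast
  \<comment> \<open>The easy inclusion: the augmented matrix vanishes, so every block-constant
    vector is annihilated.\<close>
  have "map_mat augmentation (mat_star M) = 0\<^sub>m (dim_col M) ?n"
    using M by (intro eq_matI) (simp_all add: all_entries_def mat_star_def augmentation_star)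
  moreover have "0\<^sub>m (dim_col M) ?n *\<^sub>v x = 0\<^sub>v (dim_col M)"
    using x(1) by (intro eq_vecI) simp_all
  ultimately have "bin_mat (mat_star M) *\<^sub>v v = block_const_vec ?p (0\<^sub>v (dim_col M))"
    using x by (simp add: bin_mat_mult_block_const_vec)
  also have "\<dots> = 0\<^sub>v (dim_col M * ?p)"
    by (rule eq_vecI) (simp_all add: block_const_vec_def less_mult_imp_div_mod_less)
  finally show "v \<in> mat_kernel (bin_mat (mat_star M))"
    using x by (simp add: mat_kernel_def)
next
  let ?p = "CARD('p)" and ?n = "dim_row M"
  let ?B = "bin_mat M"
  fix v assume "v \<in> mat_kernel (bin_mat (mat_star M))"
  then have v: "v \<in> carrier_vec (?n * ?p)" "transpose_mat ?B *\<^sub>v v = 0\<^sub>v (dim_col ?B)"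
    by (simp_all add: mat_kernel_def bin_mat_star)
  \<comment> \<open>The span is contained in this finite set and is at least as large, hence equal
    to it.\<close>
  have "card (col_span ?B) \<ge> card (zero_sum_blocks ?n ?p :: bit vec set)"
    unfolding card_col_span rank by (rule card_zero_sum_blocks_le[OF p])
  then have span: "col_span ?B = zero_sum_blocks ?n ?p"
    by (rule card_seteq[OF finite_zero_sum_blocks col_span_bin_mat_zero_sum_blocks[OF M]])
  \<comment> \<open>The vectors orthogonal to the fixed v form a subspace. It contains the columns
    because v is in the kernel of the transpose, so it contains their span.\<close>
  let ?W = "{w \<in> carrier_vec (?n * ?p). w \<bullet> v = 0}"
  have "col_span ?B \<subseteq> ?W"
  proof (rule col_span_subset)
    show "set (cols ?B) \<subseteq> ?W"
    proof
      fix w assume "w \<in> set (cols ?B)"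
      then obtain j where j: "j < dim_col ?B" "w = col ?B j"
        by (auto simp: cols_def)
      then have "w \<bullet> v = (transpose_mat ?B *\<^sub>v v) $ j" by simp
      also have "\<dots> = 0"
        unfolding v(2) by (rule index_zero_vec(1)[OF j(1)])
      finally have "w \<bullet> v = 0" .
      moreover have "w \<in> carrier_vec (?n * ?p)"
        using col_dim[of ?B j] j(2) by simp
      ultimately show "w \<in> ?W" by blast
    qed
    show "LinearCombinations.submodule class_ring ?W (module_vec TYPE(bit) (dim_row ?B))"
      using v(1) by (intro submodule_bit_vecI) (auto simp: add_scalar_prod_distrib)
  qed
  then show "v \<in> block_const_vec ?p ` carrier_vec ?n"
    using v(1) unfolding span by (intro orthogonal_zero_sum_blocks) auto
qed

section \<open>Non-zero minors over the ring and kernels over the two-element field\<close>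

lemma minor_rank_minor:
  obtains I J where "I \<subseteq> {..<dim_row A}" "J \<subseteq> {..<dim_col A}" "card I = minor_rank A"
    "card J = minor_rank A" "det (submatrix A I J) \<noteq> 0"
proof -
  let ?S = "{r. \<exists>I J. I \<subseteq> {..<dim_row A} \<and> J \<subseteq> {..<dim_col A} \<and>
     card I = r \<and> card J = r \<and> det (submatrix A I J) \<noteq> 0}"
  have "?S \<subseteq> {..dim_row A}"
    by (auto dest!: card_mono[OF finite_lessThan])
  then have "finite ?S" by (rule finite_subset) simp
  \<comment> \<open>The empty minor keeps the set non-empty, so the maximum is attained.\<close>
  moreover have "0 \<in> ?S"
    by (auto simp: submatrix_def intro!: exI[of _ "{}"])
  ultimately have "minor_rank A \<in> ?S"
    unfolding minor_rank_def by (intro Max_in) auto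
  then show ?thesis using that by blast
qed

lemma pick_lessThan: "i < n \<Longrightarrow> pick {..<n} i = i"
proof -
  assume i: "i < n"
  then have "{a \<in> {..<n}. a < i} = {..<i}" by auto
  then show ?thesis using pick_card_in_set[of i "{..<n}"] i by simp
qed

text \<open>A non-zero minor of full row size uses every row and descends to a non-zero determinant
  over F_2. The equations given by its columns alone then force x = 0, since F_2 is a field.\<close>

lemma full_row_minor_rank_kernel:
  fixes C :: "bit mat"
  assumes rank: "minor_rank (map_mat bit_to_cyc C :: 'p cyc mat) = dim_row C"
    and x: "x \<in> carrier_vec (dim_row C)" "transpose_mat C *\<^sub>v x = 0\<^sub>v (dim_col C)"
  shows "x = 0\<^sub>v (dim_row C)"
proof -
  interpret h: comm_ring_hom "bit_to_cyc :: bit \<Rightarrow> 'p cyc" by (rule comm_ring_hom_bit_to_cyc)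
  let ?M = "map_mat bit_to_cyc C :: 'p cyc mat" and ?n = "dim_row C"
  obtain I J where IJ: "I \<subseteq> {..<?n}" "J \<subseteq> {..<dim_col C}" "card I = ?n" "card J = ?n"
    "det (submatrix ?M I J) \<noteq> 0"
    using minor_rank_minor[of ?M] rank by auto
  have I: "I = {..<?n}" using IJ by (intro card_subset_eq) simp_all
  have Jcard: "card {j. j < dim_col C \<and> j \<in> J} = ?n"
    using IJ(2,4) by (metis (no_types, lifting) Collect_mem_eq Collect_cong lessThan_iff subsetD)
  have Icard: "card {i. i < ?n \<and> i \<in> I} = ?n"
    unfolding I by simp
  let ?D = "submatrix C I J"
  have D: "?D \<in> carrier_mat ?n ?n"
    by (rule carrier_matI) (simp_all only: dim_submatrix Icard Jcard)
  have pickJ: "pick J j < dim_col C" if "j < ?n" for j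
    using that Jcard by (intro pick_le) simp
  have D_index: "?D $$ (i, j) = C $$ (i, pick J j)" if "i < ?n" "j < ?n" for i j
    using that by (subst submatrix_index) (simp_all add: Jcard Icard, simp add: I pick_lessThan)
  have "submatrix ?M I J = map_mat bit_to_cyc ?D"
    unfolding submatrix_def by (rule eq_matI) (auto simp: pick_le)
  \<comment> \<open>If this determinant were 0, its image under \<open>bit_to_cyc\<close>, which is
    the chosen minor over R, would be 0 as well.\<close>
  then have "det ?D \<noteq> 0"
    using IJ(5) by (metis h.hom_det h.hom_zero)
  then have det: "det (transpose_mat ?D) \<noteq> 0"
    using det_transpose[OF D] by simp
  \<comment> \<open>All rows are kept in order, so this product only selects the coordinates of
    \<open>transpose_mat C *\<^sub>v x\<close> indexed by J.\<close>
  have "transpose_mat ?D *\<^sub>v x = 0\<^sub>v ?n"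
  proof (rule eq_vecI)
    fix j assume "j < dim_vec (0\<^sub>v ?n :: bit vec)"
    then have j: "j < ?n" by simp
    have "(transpose_mat ?D *\<^sub>v x) $ j = (\<Sum>i<?n. C $$ (i, pick J j) * x $ i)"
      using D x(1) j by (simp add: scalar_prod_def lessThan_atLeast0 D_index)
    also have "\<dots> = (transpose_mat C *\<^sub>v x) $ pick J j"
      using x(1) pickJ[OF j] by (simp add: scalar_prod_def lessThan_atLeast0)
    also have "\<dots> = 0\<^sub>v ?n $ j"
      unfolding x(2) using j pickJ[OF j] by (simp only: index_zero_vec(1))
    finally show "(transpose_mat ?D *\<^sub>v x) $ j = 0\<^sub>v ?n $ j" .
  qed (use D in simp)
  then show ?thesis
    using det det_0_iff_vec_prod_zero_field[of "transpose_mat ?D" ?n] D x by auto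
qed

section \<open>From the code hypotheses to the merge count\<close>

lemma cc_seed_augmentation:
  assumes "cc_seed n A"
  shows "all_entries (\<lambda>q. augmentation q = 0) A"
  unfolding all_entries_def
proof (intro allI impI)
  fix i j assume "i < dim_row A" "j < dim_col A"
  with assms have "A $$ (i, j) = 0 \<or> cyc_binomial (A $$ (i, j))"
    unfolding cc_seed_def by (metis carrier_matD)
  then show "augmentation (A $$ (i, j)) = 0"
    by (elim disjE) (simp_all add: augmentation_binomial)
qed

lemma mult_mat_zero_vec: "A *\<^sub>v 0\<^sub>v (dim_col A) = 0\<^sub>v (dim_row A)"
  by (intro eq_vecI) simp_all

text \<open>On the block-constant kernel, the map defining the merges is the transposed augmentation
  of H_Z' followed by block repetition. Repetition is injective, so the two images have the same
  size.\<close>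

lemma num_Z_merges_eq:
  fixes Ha Hb Ha' Hb' :: "'p cyc mat"
  assumes p: "0 < CARD('p)"
    and ker: "mat_kernel (bin_mat (mat_star (lp_HZ Ha Hb))) = block_const_vec CARD('p) ` carrier_vec n"
    and n: "dim_row (lp_HZ Ha' Hb') = n"
  shows "2 ^ num_Z_merges Ha Hb Ha' Hb' =
    card ((\<lambda>x. transpose_mat (map_mat augmentation (lp_HZ Ha' Hb')) *\<^sub>v x) ` carrier_vec n)"
proof -
  let ?p = "CARD('p)" and ?H = "lp_HZ Ha' Hb'"
  let ?C = "map_mat augmentation ?H" and ?T = "bin_mat (mat_star ?H)"
  let ?f = "\<lambda>x. transpose_mat ?C *\<^sub>v x"
  let ?W = "(\<lambda>v. ?T *\<^sub>v v) ` block_const_vec ?p ` carrier_vec n"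
  have T: "?T *\<^sub>v block_const_vec ?p x = block_const_vec ?p (?f x)" if "x \<in> carrier_vec n" for x
    using that n by (simp add: bin_mat_mult_block_const_vec map_mat_augmentation_star)
  have W: "?W = block_const_vec ?p ` ?f ` carrier_vec n"
    unfolding image_image by (rule image_cong[OF refl T])
  have f: "?f x \<in> carrier_vec (dim_col ?H)" if "x \<in> carrier_vec n" for x
    by (rule carrier_vecI) simp
  have sub: "LinearCombinations.submodule class_ring ?W (module_vec TYPE(bit) (dim_row ?T))"
  proof (rule submodule_bit_vecI)
    show "?W \<subseteq> carrier_vec (dim_row ?T)"
      by (intro image_subsetI carrier_vecI) simp
    have "block_const_vec ?p (0\<^sub>v n :: bit vec) = 0\<^sub>v (dim_col ?T)"
      using n by (intro eq_vecI) (simp_all add: block_const_vec_def less_mult_imp_div_mod_less)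
    then have "?T *\<^sub>v block_const_vec ?p (0\<^sub>v n) = 0\<^sub>v (dim_row ?T)"
      by (simp only: mult_mat_zero_vec)
    then show "0\<^sub>v (dim_row ?T) \<in> ?W"
      by (rule image_eqI[OF sym imageI[OF zero_carrier_vec]])
    fix v w assume "v \<in> ?W" "w \<in> ?W"
    then obtain x y where xy: "x \<in> carrier_vec n" "y \<in> carrier_vec n"
      "v = ?T *\<^sub>v block_const_vec ?p x" "w = ?T *\<^sub>v block_const_vec ?p y" by blast
    have add: "block_const_vec ?p (x + y) = block_const_vec ?p x + block_const_vec ?p y"
      using xy(1,2) by (intro eq_vecI) (simp_all add: block_const_vec_def less_mult_imp_div_mod_less)
    have T_carrier: "?T \<in> carrier_mat (dim_row ?T) (n * ?p)"
      using n by (intro carrier_matI) simp_all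
    have "v + w = ?T *\<^sub>v block_const_vec ?p (x + y)"
      unfolding xy(3,4) add
      by (rule mult_add_distrib_mat_vec[OF T_carrier block_const_vec_carrier[OF xy(1)]
            block_const_vec_carrier[OF xy(2)], symmetric])
    then show "v + w \<in> ?W"
      by (rule image_eqI[OF _ imageI[OF add_carrier_vec[OF xy(1,2)]]])
  qed
  have "2 ^ num_Z_merges Ha Hb Ha' Hb' = card ?W"
    unfolding num_Z_merges_def Let_def ker by (rule card_submodule_bit_vec[OF sub, symmetric])
  also have "\<dots> = card (?f ` carrier_vec n)"
    unfolding W using f
    by (intro card_image inj_on_subset[OF inj_on_block_const_vec[OF p, of "dim_col ?H"]]) blast
  finally show ?thesis .
qed

lemma connection_seed_entries:
  "connection_seed n A \<Longrightarrow> all_entries (\<lambda>q. q \<in> {0, 1}) A"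
  unfolding connection_seed_def all_entries_def by (metis carrier_matD)

text \<open>Both rank bounds are required: with k = 2N, where N = \<open>na * nb\<close>, the ranks
  of the X- and Z-checks add up to the sum of their bounds, so the Z-rank attains its own.\<close>

lemma cc_kernel:
  fixes Ha Hb :: "'p cyc mat"
  assumes p: "0 < CARD('p)" and a: "cc_seed na Ha" and b: "cc_seed nb Hb"
    and k: "cc_logical_qubits Ha Hb = 2 * na * nb"
  shows "mat_kernel (bin_mat (mat_star (lp_HZ Ha Hb))) = block_const_vec CARD('p) ` carrier_vec (na * nb)"
proof -
  have carr: "Ha \<in> carrier_mat na na" "Hb \<in> carrier_mat nb nb" and pos: "0 < na * nb"
    using a b by (auto simp: cc_seed_def)
  note aug = cc_seed_augmentation[OF a] cc_seed_augmentation[OF b]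
  have X: "all_entries (\<lambda>q. augmentation q = 0) (lp_HX Ha Hb)"
    using carr aug by (rule all_entries_lp_HX) simp
  have Z: "all_entries (\<lambda>q. augmentation q = 0) (lp_HZ Ha Hb)"
    using carr aug by (rule all_entries_lp_HZ) (simp_all add: augmentation_star)
  note dims = dim_lp_HX[OF carr] dim_lp_HZ[OF carr]
  have "bit_rank (bin_mat (lp_HX Ha Hb)) \<le> na * nb * (CARD('p) - 1)"
    "bit_rank (bin_mat (lp_HZ Ha Hb)) \<le> na * nb * (CARD('p) - 1)"
    using bit_rank_bin_mat_le[OF X p] bit_rank_bin_mat_le[OF Z p] by (simp_all add: dims)
  \<comment> \<open>The subtraction on naturals is truncated, but the two bounds leave at least 2N,
    so nothing is cut off.\<close>
  moreover have "2 * (na * nb) * CARD('p) - bit_rank (bin_mat (lp_HX Ha Hb))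
      - bit_rank (bin_mat (lp_HZ Ha Hb)) = 2 * (na * nb)"
    using k by (simp add: cc_logical_qubits_def css_logical_qubits_def dims)
  moreover have "2 * (na * nb) * CARD('p) = 2 * (na * nb * (CARD('p) - 1)) + 2 * (na * nb)"
    using p by (cases "CARD('p)") (simp_all add: algebra_simps)
  ultimately have "bit_rank (bin_mat (lp_HZ Ha Hb)) = na * nb * (CARD('p) - 1)"
    using pos by linarith
  then show ?thesis
    using mat_kernel_bin_mat_star[OF Z p] by (simp add: dims)
qed

theorem theoremV9:
  fixes Ha Hb :: "'p cyc mat" and n\<^sub>a n\<^sub>b k :: nat
  assumes "prime CARD('p)"
    and "cc_seed n\<^sub>a Ha" and "cc_seed n\<^sub>b Hb"
    and "k = cc_logical_qubits Ha Hb" and "k = 2 * n\<^sub>a * n\<^sub>b"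
  shows "real k / 2 = real (n\<^sub>a * n\<^sub>b) \<and>
    (\<forall>(Ha' :: 'p cyc mat) (Hb' :: 'p cyc mat).
      connection_seed n\<^sub>a Ha' \<longrightarrow> connection_seed n\<^sub>b Hb' \<longrightarrow>
        num_Z_merges Ha Hb Ha' Hb' \<le> n\<^sub>a * n\<^sub>b \<and>
        (minor_rank (lp_HZ Ha' Hb') = n\<^sub>a * n\<^sub>b \<longrightarrow> num_Z_merges Ha Hb Ha' Hb' = n\<^sub>a * n\<^sub>b))"
proof (intro conjI allI impI)
  show "real k / 2 = real (n\<^sub>a * n\<^sub>b)" using assms(5) by simp
next
  fix Ha' Hb' :: "'p cyc mat"
  assume a: "connection_seed n\<^sub>a Ha'" and b: "connection_seed n\<^sub>b Hb'"
  let ?n = "n\<^sub>a * n\<^sub>b" and ?H = "lp_HZ Ha' Hb'"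
  let ?C = "map_mat augmentation ?H"
  let ?f = "\<lambda>x. transpose_mat ?C *\<^sub>v x"
  have p: "0 < CARD('p)" using assms(1) by (simp add: prime_gt_0_nat)
  have carr: "Ha' \<in> carrier_mat n\<^sub>a n\<^sub>a" "Hb' \<in> carrier_mat n\<^sub>b n\<^sub>b"
    using a b by (simp_all add: connection_seed_def)
  note dims = dim_lp_HZ[OF carr]
  \<comment> \<open>The upper bound follows because an image is no larger than its domain of 2^N
    vectors; equality will amount to injectivity of \<open>?f\<close>.\<close>
  have merges: "2 ^ num_Z_merges Ha Hb Ha' Hb' = card (?f ` carrier_vec ?n)"
    using cc_kernel[OF p assms(2,3)] assms(4,5) dims by (intro num_Z_merges_eq[OF p]) simp_all
  also have "\<dots> \<le> card (carrier_vec ?n :: bit vec set)"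
    by (rule card_image_le[OF finite_carrier_vec_bit])
  also have "\<dots> = 2 ^ ?n" by (rule card_carrier_vec_bit)
  finally show "num_Z_merges Ha Hb Ha' Hb' \<le> ?n" by simp
  assume rank: "minor_rank ?H = ?n"
  have entries: "all_entries (\<lambda>q. q \<in> {0, 1}) ?H"
    using carr connection_seed_entries[OF a] connection_seed_entries[OF b]
    by (rule all_entries_lp_HZ) (auto simp: cyc_star_1[OF p])
  \<comment> \<open>Entries 0 and 1 are unchanged by augmenting and embedding back, so the rank
    hypothesis on \<open>?H\<close> concerns the lift of the binary matrix
    \<open>?C\<close>.\<close>
  have H: "map_mat bit_to_cyc ?C = ?H"
  proof (intro eq_matI)
    fix i j assume ij: "i < dim_row ?H" "j < dim_col ?H"
    then have "?H $$ (i, j) = 0 \<or> ?H $$ (i, j) = 1"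
      using entries unfolding all_entries_def by blast
    then have "bit_to_cyc (augmentation (?H $$ (i, j))) = ?H $$ (i, j)"
      by (elim disjE) (simp_all add: bit_to_cyc_def augmentation_1[OF p])
    with ij show "map_mat bit_to_cyc ?C $$ (i, j) = ?H $$ (i, j)" by simp
  qed simp_all
  \<comment> \<open>The difference of two vectors with equal image lies in the kernel of the
    transpose of \<open>?C\<close>, which the full row minor makes trivial.\<close>
  have "inj_on ?f (carrier_vec ?n)"
  proof (rule inj_onI)
    fix x y assume xy: "x \<in> carrier_vec ?n" "y \<in> carrier_vec ?n" "?f x = ?f y"
    have "?f (x - y) = ?f x - ?f y"
      using xy dims by (intro mult_minus_distrib_mat_vec[where nc = ?n]) auto
    also have "\<dots> = 0\<^sub>v (dim_col ?C)"
      using xy(3) by (intro eq_vecI) simp_all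
    finally have "x - y = 0\<^sub>v ?n"
      using full_row_minor_rank_kernel[of ?C "x - y", where 'p = 'p] H rank xy dims by simp
    then have "x $ i = y $ i" if "i < ?n" for i
      using xy that by (metis carrier_vecD index_minus_vec(1) index_zero_vec(1) right_minus_eq)
    then show "x = y"
      using xy(1,2) by (metis carrier_vecD eq_vecI)
  qed
  then have "card (?f ` carrier_vec ?n) = 2 ^ ?n"
    by (simp add: card_image card_carrier_vec_bit)
  with merges show "num_Z_merges Ha Hb Ha' Hb' = ?n" by simp
qed

end
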